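(* The unrestricted Wilcoxon--Mann--Whitney test is detection incoherent. That is, let $\mathcal P$ be the set of all pairs $(F_1,F_2)$ of probability distributions on $\mathbb R$, let $\mathcal H_0=\{(F_1,F_2)\in\mathcal P: F_1=F_2\}$, and let $\mathcal D_0=\{(F_1,F_2)\in\mathcal P: \mathrm{AUC}(F_1,F_2)=1/2\}$ be the detection-null set of the test. Then the blind spot $$\mathcal S_{\mathcal P}=\mathcal D_0\setminus\mathcal H_0$$ is non-empty.
   Context: For independent $X\sim F_1$, $Y\sim F_2$, put $\mathrm{AUC}(F_1,F_2)=P(X<Y)+\tfrac12 P(X=Y)$. The Wilcoxon--Mann--Whitney test is calibrated under the null $\mathcal H_0$ ($F_1=F_2$). Its detector (the component of the test statistic whose limit in probability carries the information about the null) is the empirical AUC, $\mathrm{eAUC}=U/(n_1n_2)$, where $U=\sum_{i\le n_1}\sum_{j\le n_2}\mathbf 1(X_i<Y_j)$ (with $\tfrac12\mathbf 1(X_i=Y_j)$ added in case of ties). The detector converges in probability to the detection functional $\theta(F_1,F_2)=\mathrm{AUC}(F_1,F_2)$. On $\mathcal H_0$ the functional has the constant value $\theta^*=1/2$ (the detection-null value). The detection-null set is $\mathcal D_0=\{\theta=\theta^*\}$ and the blind spot is $\mathcal S_{\mathcal P}=\mathcal D_0\setminus\mathcal H_0$. An unrestricted test (one defined over all of $\mathcal P$) is detection coherent if $\mathcal S_{\mathcal P}=\emptyset$ and detection incoherent otherwise. *)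

theory Defs
  imports "HOL-Probability.Probability"
begin

text \<open>Under the product measure the two coordinates are independent with laws \<open>F\<^sub>1\<close> and \<open>F\<^sub>2\<close>,
  so they play the roles of \<open>X\<close> and \<open>Y\<close>.\<close>

definition AUC :: "real measure \<Rightarrow> real measure \<Rightarrow> real" where
  "AUC F\<^sub>1 F\<^sub>2 =
     \<P>(p in F\<^sub>1 \<Otimes>\<^sub>M F\<^sub>2. fst p < snd p) + 1/2 * \<P>(p in F\<^sub>1 \<Otimes>\<^sub>M F\<^sub>2. fst p = snd p)"

text \<open>A test enters the following notions through its model \<open>P\<close>, its null \<open>H\<^sub>0 \<subseteq> P\<close>, its detection
  functional \<open>\<theta>\<close> (the limit in probability of its detector) and the value \<open>\<theta>s\<close> of \<open>\<theta>\<close> on \<open>H\<^sub>0\<close>.\<close>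

definition detection_null_set :: "'a set \<Rightarrow> ('a \<Rightarrow> real) \<Rightarrow> real \<Rightarrow> 'a set" where
  "detection_null_set P \<theta> \<theta>s = {p \<in> P. \<theta> p = \<theta>s}"

definition blind_spot :: "'a set \<Rightarrow> 'a set \<Rightarrow> ('a \<Rightarrow> real) \<Rightarrow> real \<Rightarrow> 'a set" where
  "blind_spot P H\<^sub>0 \<theta> \<theta>s = detection_null_set P \<theta> \<theta>s - H\<^sub>0"

definition detection_coherent :: "'a set \<Rightarrow> 'a set \<Rightarrow> ('a \<Rightarrow> real) \<Rightarrow> real \<Rightarrow> bool" where
  "detection_coherent P H\<^sub>0 \<theta> \<theta>s \<longleftrightarrow> blind_spot P H\<^sub>0 \<theta> \<theta>s = {}"

abbreviation detection_incoherent :: "'a set \<Rightarrow> 'a set \<Rightarrow> ('a \<Rightarrow> real) \<Rightarrow> real \<Rightarrow> bool" where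
  "detection_incoherent P H\<^sub>0 \<theta> \<theta>s \<equiv> \<not> detection_coherent P H\<^sub>0 \<theta> \<theta>s"

definition wmw_model :: "(real measure \<times> real measure) set" where
  "wmw_model = {(F\<^sub>1, F\<^sub>2). real_distribution F\<^sub>1 \<and> real_distribution F\<^sub>2}"

definition wmw_null :: "(real measure \<times> real measure) set" where
  "wmw_null = {(F\<^sub>1, F\<^sub>2) \<in> wmw_model. F\<^sub>1 = F\<^sub>2}"

end

(* A point mass at 0 and the uniform distribution on {-1, 1}: the second variable exceeds the
   first one with probability 1/2, and ties have probability 0. *)

theory Submission
  imports Defs
begin

text \<open>Against a point mass at x, the AUC sees of \<open>F\<close> only the mass above x and
  half the mass at x (\<open>AUC_return_left\<close>, a slicing argument). It therefore equals 1/2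
  for every law that has no atom at x and splits its mass evenly around x. Such a law is never the
  point mass itself, so the pair lies in the blind spot.\<close>

lemma real_distribution_return: "real_distribution (return borel (x::real))"
  by (simp add: real_distribution_def real_distribution_axioms_def prob_space_return)

text \<open>The measure of \<open>A\<close> is the integral of the measures of its slices;
  integrating against a point mass evaluates at \<open>x\<close>.\<close>

lemma measure_pair_return_left:
  assumes "sigma_finite_measure N" "x \<in> space M" "A \<in> sets (M \<Otimes>\<^sub>M N)"
  shows "measure (return M x \<Otimes>\<^sub>M N) A = measure N (Pair x -` A)"
proof -
  interpret sigma_finite_measure N by fact
  have "sets (return M x \<Otimes>\<^sub>M N) = sets (M \<Otimes>\<^sub>M N)"
    by (intro sets_pair_measure_cong) auto
  then have "emeasure (return M x \<Otimes>\<^sub>M N) A = (\<integral>\<^sup>+ y. emeasure N (Pair y -` A) \<partial>return M x)"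
    using assms(3) by (intro emeasure_pair_measure_alt) simp
  also have "\<dots> = emeasure N (Pair x -` A)"
    using assms(2,3) by (intro nn_integral_return measurable_emeasure_Pair)
  finally show ?thesis
    by (simp add: measure_def)
qed

lemma AUC_return_left:
  assumes "real_distribution F"
  shows "AUC (return borel x) F = measure F {x<..} + 1/2 * measure F {x}"
proof -
  interpret real_distribution F by fact
  \<comment> \<open>One statement for a general relation \<open>Q\<close> covers both terms of the
    AUC: the strict order is an open subset of the plane, the diagonal a closed one.\<close>
  have slice: "\<P>(p in return borel x \<Otimes>\<^sub>M F. Q (fst p) (snd p)) = measure F {y. Q x y}"
    if "{p. Q (fst p) (snd p)} \<in> sets (borel :: (real \<times> real) measure)"
    for Q :: "real \<Rightarrow> real \<Rightarrow> bool"
  proof -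
    have "sets (borel \<Otimes>\<^sub>M F) = sets (borel :: (real \<times> real) measure)"
      by (metis borel_prod events_eq_borel sets_pair_measure_cong)
    then show ?thesis
      using that measure_pair_return_left[OF sigma_finite_measure_axioms, of x borel "{p. Q (fst p) (snd p)}"]
      by (simp add: space_pair_measure vimage_def)
  qed
  have "\<P>(p in return borel x \<Otimes>\<^sub>M F. fst p < snd p) = measure F {y. x < y}"
    by (intro slice borel_open open_Collect_less continuous_intros)
  moreover have "\<P>(p in return borel x \<Otimes>\<^sub>M F. fst p = snd p) = measure F {y. x = y}"
    by (intro slice borel_closed closed_Collect_eq continuous_intros)
  ultimately show ?thesis
    by (simp add: AUC_def greaterThan_def)
qed

theorem mainTheorem1:
  shows "detection_incoherent wmw_model wmw_null (\<lambda>(F\<^sub>1, F\<^sub>2). AUC F\<^sub>1 F\<^sub>2) (1/2)"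
proof -
  define B where "B = measure_pmf (bernoulli_pmf (1/2))"
  \<comment> \<open>The fair coin is pushed forward to \<open>borel\<close> because
    \<open>real_distribution\<close> demands the Borel sigma-algebra, whereas in a
    \<open>pmf\<close> measure every set is measurable.\<close>
  define F where "F = distr B borel (\<lambda>b. if b then 1 else - 1 :: real)"
  interpret F: real_distribution F
    unfolding F_def B_def by (intro prob_space.real_distribution_distr measure_pmf.prob_space_axioms) simp
  have F_eq: "measure F A = measure B ((\<lambda>b. if b then 1 else - 1) -` A)" if "A \<in> sets borel" for A
    using that by (simp add: F_def B_def measure_distr)
  have "(\<lambda>b. if b then 1 else - 1 :: real) -` {0<..} = {True}"
    "(\<lambda>b. if b then 1 else - 1 :: real) -` {0} = {}"
    by (auto split: if_splits)
  then have F_gt: "measure F {0<..} = 1/2" and F_0: "measure F {0} = 0"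
    by (simp_all add: F_eq B_def measure_pmf_single)
  \<comment> \<open>The mass of {0} tells the two laws apart: 1 against 0.\<close>
  have "return borel 0 \<noteq> F"
    using F_0 by (auto simp: measure_return)
  moreover have "AUC (return borel 0) F = 1/2"
    using F_gt F_0 by (simp add: AUC_return_left F.real_distribution_axioms)
  ultimately have "(return borel 0, F) \<in> blind_spot wmw_model wmw_null (\<lambda>(F\<^sub>1, F\<^sub>2). AUC F\<^sub>1 F\<^sub>2) (1/2)"
    by (simp add: blind_spot_def detection_null_set_def wmw_model_def wmw_null_def
        real_distribution_return F.real_distribution_axioms)
  then show ?thesis
    by (auto simp: detection_coherent_def)
qed

end
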